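(* Consider the chance constrained program without recourse opportunities and with random right-hand side only, with $h_k\ge 0$ for all $k=1,\dots,K$: $$\theta^*(\varepsilon)=\min\Big\{cx:\ Ax\ge b,\ (Gx-h_k)(1-z_k)\ge 0\ \ \forall k,\ \sum_{k=1}^K\pi_kz_k\le\varepsilon,\ x\in\mathbb{R}^{n_1}_+\times\mathbb{Z}^{n_2}_+,\ z\in\{0,1\}^K\Big\}.$$ Then the linear model $$\theta^*(\varepsilon)=\min\Big\{cx:\ Ax\ge b,\ \sum_{k=1}^K\pi_kz_k\le\varepsilon,\ Gx+\big(h_k-\min_{l=1,\dots,K}\{h_l\}\big)z_k\ge h_k\ \ \forall k,\ x\in\mathbb{R}^{n_1}_+\times\mathbb{Z}^{n_2}_+,\ z\in\{0,1\}^K\Big\}$$ is a valid formulation of this chance constrained program. Moreover, it dominates the following linear formulation, which has been adopted in earlier literature as a formulation of such chance constrained programs: $$\theta^*(\varepsilon)=\min\Big\{cx:\ Ax\ge b,\ \sum_{k=1}^K\pi_kz_k\le\varepsilon,\ Gx+h_kz_k\ge h_k\ \ \forall k,\ x\in\mathbb{R}^{n_1}_+\times\mathbb{Z}^{n_2}_+,\ z\in\{0,1\}^K\Big\}.$$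
   Context: $K$ is the number of scenarios, $\pi_k\ge 0$ are their probabilities with $\sum_k\pi_k=1$, and $\varepsilon$ is the risk tolerance level, $0\le\varepsilon\le 1$; $A,b,c,G,h_k$ are real matrices/vectors of compatible dimensions. The set $X=\{x\in\mathbb{R}^{n_1}_+\times\mathbb{Z}^{n_2}_+: Ax\ge b\}$ is assumed nonempty, and for every scenario $k$ there is assumed to exist $x^0\in X$ with $Gx^0\ge h_k$. The minimum $\min_l\{h_l\}$ of vectors is taken componentwise, and vector inequalities are componentwise. Optimal values are $+\infty$ if infeasible and $-\infty$ if unbounded. A model is a valid formulation of the chance constrained program if a first-stage vector $x$ can be extended to a feasible solution of the model if and only if it can be extended to a feasible solution of the chance constrained program, and the two optimal values coincide. One linear formulation dominates another in the same variables if every point feasible for its continuous relaxation (integrality dropped, $z\in[0,1]^K$) is feasible for the continuous relaxation of the other.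
   Formalization: Validity and the equality of optimal values are stated for ε < 1 only, since at ε = 1 the choice z = (1,…,1) lifts all conditions on Gx while the linear model still demands Gx ≥ min h; dominance is stated for all 0 ≤ ε ≤ 1. *)

theory Defs
  imports "HOL-Analysis.Analysis"
begin

text \<open>The index set \<open>I\<close> collects the integer coordinates of \<open>x\<close>, so that
  \<open>n\<^sub>2 = card I\<close> and \<open>n\<^sub>1 = card (- I)\<close>; either of the two may be zero.\<close>

definition mixed_nonneg :: "'n set \<Rightarrow> (real^'n) set" where
  "mixed_nonneg I = {x. 0 \<le> x \<and> (\<forall>j\<in>I. x $ j \<in> \<int>)}"

definition first_stage_set :: "'n set \<Rightarrow> real^'n^'m \<Rightarrow> real^'m \<Rightarrow> (real^'n) set" where
  "first_stage_set I A b = {x \<in> mixed_nonneg I. A *v x \<ge> b}"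

definition binary :: "(real^'k) set" where
  "binary = {z. \<forall>k. z $ k \<in> {0, 1}}"

definition cmin :: "('k::finite \<Rightarrow> real^'p) \<Rightarrow> real^'p" where
  "cmin h = (\<chi> i. Min (range (\<lambda>l. h l $ i)))"

text \<open>A model is represented by its set of feasible pairs (first-stage vector, other variables).
  The infimum in the extended reals is \<open>\<infinity>\<close> for an infeasible and \<open>-\<infinity>\<close> for an
  unbounded model.\<close>

definition optimal_value :: "real^'n \<Rightarrow> ((real^'n) \<times> 'z) set \<Rightarrow> ereal" where
  "optimal_value c F = (INF (x, z)\<in>F. ereal (c \<bullet> x))"

definition valid_formulation ::
  "real^'n \<Rightarrow> ((real^'n) \<times> 'w) set \<Rightarrow> ((real^'n) \<times> 'z) set \<Rightarrow> bool" where
  "valid_formulation c F P \<longleftrightarrow>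
     (\<forall>x. (\<exists>w. (x, w) \<in> F) \<longleftrightarrow> (\<exists>z. (x, z) \<in> P)) \<and>
     optimal_value c F = optimal_value c P"

definition ccp ::
  "'n set \<Rightarrow> real^'n^'m \<Rightarrow> real^'m \<Rightarrow> real^'n^'p \<Rightarrow> ('k::finite \<Rightarrow> real^'p) \<Rightarrow>
   ('k \<Rightarrow> real) \<Rightarrow> real \<Rightarrow> ((real^'n) \<times> (real^'k)) set" where
  "ccp I A b G h \<pi> \<epsilon> =
     {(x, z). A *v x \<ge> b \<and>
        (\<forall>k. (1 - z $ k) *\<^sub>R (G *v x - h k) \<ge> 0) \<and>
        (\<Sum>k\<in>UNIV. \<pi> k * z $ k) \<le> \<epsilon> \<and>
        x \<in> mixed_nonneg I \<and> z \<in> binary}"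

text \<open>A linear formulation is given by its linear constraints alone; the domains of the variables
  are added by \<open>integer_feasible\<close> and, with integrality dropped, by \<open>relaxation\<close>.\<close>

definition improved_constraints ::
  "real^'n^'m \<Rightarrow> real^'m \<Rightarrow> real^'n^'p \<Rightarrow> ('k::finite \<Rightarrow> real^'p) \<Rightarrow>
   ('k \<Rightarrow> real) \<Rightarrow> real \<Rightarrow> ((real^'n) \<times> (real^'k)) set" where
  "improved_constraints A b G h \<pi> \<epsilon> =
     {(x, z). A *v x \<ge> b \<and>
        (\<Sum>k\<in>UNIV. \<pi> k * z $ k) \<le> \<epsilon> \<and>
        (\<forall>k. G *v x + z $ k *\<^sub>R (h k - cmin h) \<ge> h k)}"

definition standard_constraints ::
  "real^'n^'m \<Rightarrow> real^'m \<Rightarrow> real^'n^'p \<Rightarrow> ('k::finite \<Rightarrow> real^'p) \<Rightarrow>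
   ('k \<Rightarrow> real) \<Rightarrow> real \<Rightarrow> ((real^'n) \<times> (real^'k)) set" where
  "standard_constraints A b G h \<pi> \<epsilon> =
     {(x, z). A *v x \<ge> b \<and>
        (\<Sum>k\<in>UNIV. \<pi> k * z $ k) \<le> \<epsilon> \<and>
        (\<forall>k. G *v x + z $ k *\<^sub>R h k \<ge> h k)}"

text \<open>For \<open>\<epsilon> = 1\<close> the vector \<open>z = 1\<close> is feasible in \<open>ccp\<close> with no condition on
  \<open>G *v x\<close>, whereas \<open>improved_constraints\<close> still requires \<open>G *v x \<ge> cmin h\<close> and
  \<open>standard_constraints\<close> requires \<open>G *v x \<ge> 0\<close>: equivalence with \<open>ccp\<close> needs
  \<open>\<epsilon> < 1\<close>, which excludes \<open>z = 1\<close>.\<close>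

definition integer_feasible ::
  "'n set \<Rightarrow> ((real^'n) \<times> (real^'k)) set \<Rightarrow> ((real^'n) \<times> (real^'k)) set" where
  "integer_feasible I L = {(x, z) \<in> L. x \<in> mixed_nonneg I \<and> z \<in> binary}"

definition relaxation :: "((real^'n) \<times> (real^'k)) set \<Rightarrow> ((real^'n) \<times> (real^'k)) set" where
  "relaxation L = {(x, z) \<in> L. 0 \<le> x \<and> (\<forall>k. 0 \<le> z $ k \<and> z $ k \<le> 1)}"

definition dominates :: "((real^'n) \<times> (real^'k)) set \<Rightarrow> ((real^'n) \<times> (real^'k)) set \<Rightarrow> bool" where
  "dominates L L' \<longleftrightarrow> relaxation L \<subseteq> relaxation L'"

end

theory Submission
  imports Defs
begin

text \<open>If \<open>\<epsilon> < 1\<close>, every admissible binary \<open>z\<close> has some \<open>z $ k = 0\<close>, so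
  \<open>G *v x \<ge> h k \<ge> v\<close> for every common lower bound \<open>v\<close> of the \<open>h l\<close>. Hence
  the big-M constraints with \<open>v\<close> in place of the minimum describe exactly the feasible set of the
  chance constrained program. The two linear formulations are the cases \<open>v = cmin h\<close> and
  \<open>v = 0\<close>.\<close>

lemma cmin_le: "cmin h \<le> h k"
  by (auto simp: cmin_def less_eq_vec_def intro: Min_le)

lemma cmin_greatest:
  assumes "\<And>k. v \<le> h k"
  shows "v \<le> cmin h"
  using assms by (auto simp: cmin_def less_eq_vec_def)

text \<open>Otherwise \<open>z\<close> would be the all-ones vector, whose weighted sum is the total
  probability 1.\<close>

lemma binary_zero_component:
  fixes \<pi> :: "'k::finite \<Rightarrow> real"
  assumes "z \<in> binary" "(\<Sum>k\<in>UNIV. \<pi> k) = 1" "(\<Sum>k\<in>UNIV. \<pi> k * z $ k) < 1"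
  obtains k where "z $ k = 0"
proof -
  have "\<exists>k. z $ k = 0"
  proof (rule ccontr)
    assume "\<nexists>k. z $ k = 0"
    then have "z $ k = 1" for k
      using assms(1) by (auto simp: binary_def)
    then show False
      using assms(2,3) by simp
  qed
  then show thesis
    using that by blast
qed

text \<open>The two families can differ only at scenarios with \<open>z $ k = 1\<close>: there the
  scaled constraint is vacuous, while the linear one still demands \<open>v \<le> y\<close>. The
  scenario \<open>k0\<close> is what guarantees this demand.\<close>

lemma scaled_iff_lower_bound_constraints:
  fixes h :: "'k::finite \<Rightarrow> real^'p" and y :: "real^'p"
  assumes "z \<in> binary" "z $ k0 = 0" and lower: "\<And>k. v \<le> h k"
  shows "(\<forall>k. (1 - z $ k) *\<^sub>R (y - h k) \<ge> 0) \<longleftrightarrow> (\<forall>k. y + z $ k *\<^sub>R (h k - v) \<ge> h k)"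
    (is "(\<forall>k. ?L k) \<longleftrightarrow> (\<forall>k. ?R k)")
proof -
  have zero: "?L k \<longleftrightarrow> h k \<le> y" "?R k \<longleftrightarrow> h k \<le> y" if "z $ k = 0" for k
    using that by (simp_all add: less_eq_vec_def)
  have one: "?L k" "?R k \<longleftrightarrow> v \<le> y" if "z $ k = 1" for k
    using that by (simp_all add: less_eq_vec_def)
  have binary: "z $ k = 0 \<or> z $ k = 1" for k
    using assms(1) by (auto simp: binary_def)
  \<comment> \<open>Either family, taken at \<open>k0\<close>, yields the premise
    \<open>h k0 \<le> y\<close>.\<close>
  have "v \<le> y" if "h k0 \<le> y"
    using lower that by (rule order_trans)
  then show ?thesis
    using zero one binary assms(2) by metis
qed

lemma ccp_eq_lower_bound_constraints:
  assumes "(\<Sum>k\<in>UNIV. \<pi> k) = 1" "\<epsilon> < 1" "\<And>k. v \<le> h k"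
  shows "ccp I A b G h \<pi> \<epsilon> =
    integer_feasible I {(x, z). A *v x \<ge> b \<and> (\<Sum>k\<in>UNIV. \<pi> k * z $ k) \<le> \<epsilon> \<and>
      (\<forall>k. G *v x + z $ k *\<^sub>R (h k - v) \<ge> h k)}"
proof -
  \<comment> \<open>The equivalence is claimed only for binary \<open>z\<close> within the risk
    budget; the all-ones vector would break it. All remaining constraints are literally shared by
    the two sets.\<close>
  have "(\<forall>k. (1 - z $ k) *\<^sub>R (G *v x - h k) \<ge> 0) \<longleftrightarrow>
      (\<forall>k. G *v x + z $ k *\<^sub>R (h k - v) \<ge> h k)"
    if z: "z \<in> binary" "(\<Sum>k\<in>UNIV. \<pi> k * z $ k) \<le> \<epsilon>" for x z
  proof -
    obtain k0 where "z $ k0 = 0"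
      using binary_zero_component[OF z(1) assms(1)] z(2) assms(2) by (meson le_less_trans)
    then show ?thesis
      using scaled_iff_lower_bound_constraints z(1) assms(3) by blast
  qed
  then show ?thesis
    unfolding ccp_def integer_feasible_def by auto
qed

text \<open>As \<open>cmin h\<close> is nonnegative, replacing the coefficient
  \<open>h k - cmin h\<close> by \<open>h k\<close> can only enlarge the left-hand side when the
  component of \<open>z\<close> is nonnegative, fractional or not.\<close>

lemma improved_dominates_standard:
  assumes "\<And>k. 0 \<le> h k"
  shows "dominates (improved_constraints A b G h \<pi> \<epsilon>) (standard_constraints A b G h \<pi> \<epsilon>)"
proof -
  have cmin_nonneg: "0 \<le> cmin h"
    using assms by (rule cmin_greatest)
  have "h k \<le> y + t *\<^sub>R h k" if "h k \<le> y + t *\<^sub>R (h k - cmin h)" "0 \<le> t" for k y t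
  proof -
    have "t *\<^sub>R (h k - cmin h) \<le> t *\<^sub>R h k"
      using that(2) cmin_nonneg by (auto simp: less_eq_vec_def intro: mult_left_mono)
    then show ?thesis
      using that(1) by (meson add_left_mono order_trans)
  qed
  then show ?thesis
    unfolding dominates_def relaxation_def improved_constraints_def standard_constraints_def
    by auto
qed

theorem proposition2:
  fixes I :: "'n::finite set"
    and A :: "real^'n^'m::finite" and b :: "real^'m"
    and c :: "real^'n"
    and G :: "real^'n^'p::finite" and h :: "'k::finite \<Rightarrow> real^'p"
    and \<pi> :: "'k \<Rightarrow> real" and \<epsilon> :: real
  assumes prob_nonneg: "\<And>k. 0 \<le> \<pi> k"
    and prob_sum: "(\<Sum>k\<in>UNIV. \<pi> k) = 1"
    and risk: "0 \<le> \<epsilon>" "\<epsilon> \<le> 1"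
    and X_nonempty: "first_stage_set I A b \<noteq> {}"
    and scenario_feasible: "\<And>k. \<exists>x0\<in>first_stage_set I A b. G *v x0 \<ge> h k"
    and rhs_nonneg: "\<And>k. 0 \<le> h k"
  shows "(\<epsilon> < 1 \<longrightarrow>
            valid_formulation c (integer_feasible I (improved_constraints A b G h \<pi> \<epsilon>))
              (ccp I A b G h \<pi> \<epsilon>) \<and>
            optimal_value c (integer_feasible I (standard_constraints A b G h \<pi> \<epsilon>)) =
              optimal_value c (ccp I A b G h \<pi> \<epsilon>)) \<and>
         dominates (improved_constraints A b G h \<pi> \<epsilon>) (standard_constraints A b G h \<pi> \<epsilon>)"
proof (intro conjI impI)
  assume "\<epsilon> < 1"
  \<comment> \<open>Equality of the sets of pairs is stronger than validity: the same
    \<open>z\<close> serves both models.\<close>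
  have improved: "integer_feasible I (improved_constraints A b G h \<pi> \<epsilon>) = ccp I A b G h \<pi> \<epsilon>"
    unfolding improved_constraints_def
    using ccp_eq_lower_bound_constraints[OF prob_sum \<open>\<epsilon> < 1\<close> cmin_le[of h], of I A b G] by simp
  \<comment> \<open>Here \<open>v = 0\<close>, a common lower bound because the right-hand sides are
    nonnegative.\<close>
  have standard: "integer_feasible I (standard_constraints A b G h \<pi> \<epsilon>) = ccp I A b G h \<pi> \<epsilon>"
    unfolding standard_constraints_def
    using ccp_eq_lower_bound_constraints[OF prob_sum \<open>\<epsilon> < 1\<close> rhs_nonneg, of I A b G] by simp
  show "valid_formulation c (integer_feasible I (improved_constraints A b G h \<pi> \<epsilon>))
      (ccp I A b G h \<pi> \<epsilon>)"
    by (simp add: improved valid_formulation_def)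
  show "optimal_value c (integer_feasible I (standard_constraints A b G h \<pi> \<epsilon>)) =
      optimal_value c (ccp I A b G h \<pi> \<epsilon>)"
    by (simp add: standard)
\<comment> \<open>Domination stands outside the implication from \<open>\<epsilon> < 1\<close>, so
  it also covers \<open>\<epsilon> = 1\<close>.\<close>
qed (rule improved_dominates_standard[OF rhs_nonneg])

end
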